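(* Let $k\ge 1$ be an integer (with $k\le\hat\sigma$). In exact arithmetic, the stabilized residuals coincide with the classical residuals, both for the empirical interpolation method (EIM) and for the Gram--Schmidt procedure: (EIM) $(\delta^k_{\rm stab}v)(\mu)=(\delta^kv)(\mu)$ for all $\mu\in\mathcal{P}_{\rm trial}$; (Gram--Schmidt) $\delta^k_{\rm stab}v_k=\delta^kv_k$.
   Context: **EIM.** Let $\mathcal{P}_{\rm trial}$ be a finite set and $v:\mathcal{P}_{\rm trial}\to\mathbb{C}^\sigma$, with components $v_p$, $1\le p\le\sigma$. Let $1<\hat\sigma\le\sigma$. The EIM builds points $\mu_1,\mu_2,\dots,\mu_{\hat\sigma}\in\mathcal{P}_{\rm trial}$, indices $p_1,\dots,p_{\hat\sigma}$, functions $q_i:\mathcal{P}_{\rm trial}\to\mathbb{C}$ and matrices $B^k=(q_i(\mu_j))_{1\le i,j\le k}$ as follows. Choose $p_1\in{\rm argmax}_{p}\max_{\mu}|v_p(\mu)|$, $\mu_1\in{\rm argmax}_\mu|v_{p_1}(\mu)|$, $q_1(\cdot)=v_{p_1}(\cdot)/v_{p_1}(\mu_1)$. Given step $k$, define the interpolation operator $I^k$ on functions $f:\mathcal{P}_{\rm trial}\to\mathbb{C}^\sigma$ by $$(I^kf)(\mu):=\sum_{r=1}^k\lambda_r^k(\mu)f(\mu_r),\qquad B^k\lambda^k(\mu)=(q_1(\mu),\dots,q_k(\mu))^t,$$ and the classical residual operator $\delta^k:={\rm Id}-I^k$; for $k<\hat\sigma$, choose $p_{k+1}\in{\rm argmax}_p\max_\mu|(\delta^kv)_p(\mu)|$,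 $\mu_{k+1}\in{\rm argmax}_\mu|(\delta^kv)_{p_{k+1}}(\mu)|$ and set $q_{k+1}(\cdot)=(\delta^kv)_{p_{k+1}}(\cdot)/(\delta^kv)_{p_{k+1}}(\mu_{k+1})$. It is assumed that all denominators are nonzero. The intermediate residuals at step $k$ are $$\delta^{k,1}_{\rm stab}v=v-I^1v,\qquad \delta^{k,i}_{\rm stab}v=\delta^{k,i-1}_{\rm stab}v-I^i(\delta^{k,i-1}_{\rm stab}v),\quad 2\le i\le k,$$ and the stabilized residual is $\delta^k_{\rm stab}v:=\delta^{k,k}_{\rm stab}v$. **Gram--Schmidt (without normalization).** Let $(v_1,\dots,v_{\hat\sigma})$ be a basis of $\mathbb{C}^{\hat\sigma}$ and $(u_i)$ the associated orthogonal family. $\Pi^i$ denotes the orthogonal projection onto ${\rm Span}(u_1,\dots,u_i)$ and $\delta^k:={\rm Id}-\Pi^k$. The intermediate residuals at step $k$ are $\delta^{k,1}_{\rm stab}v_k=v_k-\Pi^1v_k$ and $\delta^{k,i}_{\rm stab}v_k=\delta^{k,i-1}_{\rm stab}v_k-\Pi^i\delta^{k,i-1}_{\rm stab}v_k$ for $2\le i\le k$, and the stabilized residual is $\delta^k_{\rm stab}v_k:=\delta^{k,k}_{\rm stab}v_k$. *)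

theory Defs
  imports "Jordan_Normal_Form.Gram_Schmidt"
begin

text \<open>
  Steps, points \<open>\<mu> 1, \<mu> 2, \<dots>\<close> and functions \<open>q 1, q 2, \<dots>\<close> are numbered from 1, while vector and
  matrix entries are numbered from 0 as usual for \<^typ>\<open>complex vec\<close> and \<^typ>\<open>complex mat\<close>. Thus entry
  \<open>i\<close> of a vector of length \<open>k\<close> belongs to step \<open>Suc i\<close>, and the components of a vector in
  \<open>\<complex>\<^sup>\<sigma>\<close> are indexed by \<open>{..<\<sigma>}\<close>.
\<close>

definition eim_mat :: "(nat \<Rightarrow> 'a \<Rightarrow> complex) \<Rightarrow> (nat \<Rightarrow> 'a) \<Rightarrow> nat \<Rightarrow> complex mat" where
  "eim_mat q \<mu> k = mat k k (\<lambda>(i, j). q (Suc i) (\<mu> (Suc j)))"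

text \<open>
  The matrix of a run of the method is upper triangular with unit diagonal, so that the linear
  system has exactly one solution.
\<close>

definition eim_coeff :: "(nat \<Rightarrow> 'a \<Rightarrow> complex) \<Rightarrow> (nat \<Rightarrow> 'a) \<Rightarrow> nat \<Rightarrow> 'a \<Rightarrow> complex vec" where
  "eim_coeff q \<mu> k x =
     (THE l. l \<in> carrier_vec k \<and> eim_mat q \<mu> k *\<^sub>v l = vec k (\<lambda>i. q (Suc i) x))"

definition eim_interp ::
  "nat \<Rightarrow> (nat \<Rightarrow> 'a \<Rightarrow> complex) \<Rightarrow> (nat \<Rightarrow> 'a) \<Rightarrow> nat \<Rightarrow> ('a \<Rightarrow> complex vec) \<Rightarrow> 'a \<Rightarrow> complex vec" where
  "eim_interp \<sigma> q \<mu> k f x =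
     finsum_vec TYPE(complex) \<sigma> (\<lambda>r. (eim_coeff q \<mu> k x $ (r - 1)) \<cdot>\<^sub>v f (\<mu> r)) {1..k}"

definition eim_residual ::
  "nat \<Rightarrow> (nat \<Rightarrow> 'a \<Rightarrow> complex) \<Rightarrow> (nat \<Rightarrow> 'a) \<Rightarrow> nat \<Rightarrow> ('a \<Rightarrow> complex vec) \<Rightarrow> 'a \<Rightarrow> complex vec" where
  "eim_residual \<sigma> q \<mu> k f x = f x - eim_interp \<sigma> q \<mu> k f x"

text \<open>
  One greedy selection, driven by the function \<open>g\<close>: the function \<open>v\<close> itself at the first step and
  its classical residual at the later ones. The last conjunct but one is the standing assumption
  that the denominators do not vanish. Maximisers need not be unique, so a run of the method is a
  relation and not a function.
\<close>

definition eim_select ::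
  "'a set \<Rightarrow> nat \<Rightarrow> ('a \<Rightarrow> complex vec) \<Rightarrow> nat \<Rightarrow> 'a \<Rightarrow> ('a \<Rightarrow> complex) \<Rightarrow> bool" where
  "eim_select P \<sigma> g p0 \<mu>0 q0 \<longleftrightarrow>
     is_arg_max (\<lambda>p. MAX x\<in>P. cmod (g x $ p)) (\<lambda>p. p < \<sigma>) p0 \<and>
     is_arg_max (\<lambda>x. cmod (g x $ p0)) (\<lambda>x. x \<in> P) \<mu>0 \<and>
     g \<mu>0 $ p0 \<noteq> 0 \<and>
     (\<forall>x\<in>P. q0 x = g x $ p0 / g \<mu>0 $ p0)"

definition eim_run ::
  "'a set \<Rightarrow> nat \<Rightarrow> nat \<Rightarrow> ('a \<Rightarrow> complex vec) \<Rightarrow>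
   (nat \<Rightarrow> nat) \<Rightarrow> (nat \<Rightarrow> 'a) \<Rightarrow> (nat \<Rightarrow> 'a \<Rightarrow> complex) \<Rightarrow> bool" where
  "eim_run P \<sigma> n v p \<mu> q \<longleftrightarrow>
     finite P \<and> v \<in> P \<rightarrow> carrier_vec \<sigma> \<and> 1 < n \<and> n \<le> \<sigma> \<and>
     eim_select P \<sigma> v (p 1) (\<mu> 1) (q 1) \<and>
     (\<forall>k\<in>{1..<n}. eim_select P \<sigma> (eim_residual \<sigma> q \<mu> k v) (p (k + 1)) (\<mu> (k + 1)) (q (k + 1)))"

text \<open>
  The \<open>i\<close>-th intermediate residual does not depend on the step \<open>k \<ge> i\<close> at which it is formed. The
  recursion starts from \<open>v\<close> at \<open>i = 0\<close>, so that \<open>i = 1\<close> yields \<open>v - I\<^sup>1 v\<close>.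
\<close>

primrec eim_intermediate ::
  "nat \<Rightarrow> (nat \<Rightarrow> 'a \<Rightarrow> complex) \<Rightarrow> (nat \<Rightarrow> 'a) \<Rightarrow> ('a \<Rightarrow> complex vec) \<Rightarrow> nat \<Rightarrow> 'a \<Rightarrow> complex vec" where
  "eim_intermediate \<sigma> q \<mu> v 0 = v"
| "eim_intermediate \<sigma> q \<mu> v (Suc i) =
     (\<lambda>x. eim_intermediate \<sigma> q \<mu> v i x - eim_interp \<sigma> q \<mu> (Suc i) (eim_intermediate \<sigma> q \<mu> v i) x)"

definition eim_stab_residual ::
  "nat \<Rightarrow> (nat \<Rightarrow> 'a \<Rightarrow> complex) \<Rightarrow> (nat \<Rightarrow> 'a) \<Rightarrow> nat \<Rightarrow> ('a \<Rightarrow> complex vec) \<Rightarrow> 'a \<Rightarrow> complex vec" where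
  "eim_stab_residual \<sigma> q \<mu> k v = eim_intermediate \<sigma> q \<mu> v k"

definition is_basis_list :: "nat \<Rightarrow> complex vec list \<Rightarrow> bool" where
  "is_basis_list n vs \<longleftrightarrow>
     length vs = n \<and> distinct vs \<and>
     vectorspace.basis class_ring (module_vec TYPE(complex) n) (set vs)"

text \<open>\<^term>\<open>x \<bullet>c y\<close> is the Hermitian inner product, linear in \<open>x\<close>.\<close>

definition orth_proj :: "complex vec set \<Rightarrow> complex vec \<Rightarrow> complex vec" where
  "orth_proj W x = (THE w. w \<in> W \<and> (\<forall>y\<in>W. (x - w) \<bullet>c y = 0))"

text \<open>
  \<^const>\<open>gram_schmidt\<close> does not normalise. Position \<open>i\<close> of a list carries the vector with number
  \<open>Suc i\<close>, so \<open>take i\<close> yields the vectors with numbers \<open>1, \<dots>, i\<close>.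
\<close>

definition gs_proj :: "nat \<Rightarrow> complex vec list \<Rightarrow> nat \<Rightarrow> complex vec \<Rightarrow> complex vec" where
  "gs_proj n vs i =
     orth_proj (LinearCombinations.module.span class_ring (module_vec TYPE(complex) n)
                  (set (take i (gram_schmidt n vs))))"

definition gs_residual :: "nat \<Rightarrow> complex vec list \<Rightarrow> nat \<Rightarrow> complex vec \<Rightarrow> complex vec" where
  "gs_residual n vs k x = x - gs_proj n vs k x"

primrec gs_intermediate :: "nat \<Rightarrow> complex vec list \<Rightarrow> complex vec \<Rightarrow> nat \<Rightarrow> complex vec" where
  "gs_intermediate n vs x 0 = x"
| "gs_intermediate n vs x (Suc i) =
     gs_intermediate n vs x i - gs_proj n vs (Suc i) (gs_intermediate n vs x i)"

definition gs_stab_residual :: "nat \<Rightarrow> complex vec list \<Rightarrow> nat \<Rightarrow> complex vec \<Rightarrow> complex vec" where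
  "gs_stab_residual n vs k x = gs_intermediate n vs x k"

end

theory Submission
  imports Defs
begin

text \<open>
  Write \<open>R\<^sub>i\<close> for the operator \<open>I\<^sup>i\<close> of the empirical interpolation method or for the
  projection \<open>\<Pi>\<^sup>i\<close> of the Gram--Schmidt procedure. Both parts hold because each \<open>R\<^sub>i\<close> is linear
  and fixes whatever an earlier \<open>R\<^sub>j\<close> produces: \<open>R\<^sub>i R\<^sub>j = R\<^sub>j\<close> for \<open>j \<le> i\<close>. If the intermediate
  residual after \<open>i\<close> steps is \<open>v - R\<^sub>i v\<close>, then the next one is
  \<open>(v - R\<^sub>i v) - R\<^sub>i\<^sub>+\<^sub>1 (v - R\<^sub>i v) = (v - R\<^sub>i v) - (R\<^sub>i\<^sub>+\<^sub>1 v - R\<^sub>i v) = v - R\<^sub>i\<^sub>+\<^sub>1 v\<close>,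
  and induction gives the claim.

  For the projections, \<open>R\<^sub>i R\<^sub>j = R\<^sub>j\<close> says that the spans of the first orthogonal vectors are
  nested. It remains to see that the orthogonal projections exist; the vectors computed by
  Gram--Schmidt give the usual explicit formula.

  For the interpolation operators, the components of \<open>I\<^sup>j f\<close> are linear combinations of
  \<open>q 1, \<dots>, q j\<close>, and \<open>I\<^sup>i\<close> reproduces \<open>q 1, \<dots>, q i\<close> by the very equations that define its
  coefficients (lemmas \<open>eim_coeff_reproduces\<close>, \<open>eim_coeff_interp\<close> and \<open>eim_interp_interp\<close>). This
  needs those equations to have a unique solution, which is where the greedy selection enters:
  \<open>q (Suc i)\<close> vanishes at \<open>\<mu> 1, \<dots>, \<mu> i\<close> and equals \<open>1\<close> at \<open>\<mu> (Suc i)\<close>, so the matrix of the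
  system is upper triangular with unit diagonal (lemma \<open>eim_run_det\<close>).
\<close>

section \<open>Empirical interpolation\<close>

lemma index_eim_mat_mult_vec:
  assumes "l \<in> carrier_vec k" "i < k"
  shows "(eim_mat q \<mu> k *\<^sub>v l) $ i = (\<Sum>r<k. l $ r * q (Suc i) (\<mu> (Suc r)))"
proof -
  have "(eim_mat q \<mu> k *\<^sub>v l) $ i = (\<Sum>r = 0..<k. q (Suc i) (\<mu> (Suc r)) * l $ r)"
    using assms by (auto simp: eim_mat_def scalar_prod_def intro!: sum.cong)
  then show ?thesis
    by (simp add: atLeast0LessThan mult.commute)
qed

lemma eim_coeff_eqI:
  assumes "det (eim_mat q \<mu> k) \<noteq> 0" and l: "l \<in> carrier_vec k"
    and eq: "eim_mat q \<mu> k *\<^sub>v l = vec k (\<lambda>i. q (Suc i) x)"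
  shows "eim_coeff q \<mu> k x = l"
  unfolding eim_coeff_def
proof (rule the_equality)
  show "l \<in> carrier_vec k \<and> eim_mat q \<mu> k *\<^sub>v l = vec k (\<lambda>i. q (Suc i) x)"
    using l eq by simp
next
  fix l' assume l': "l' \<in> carrier_vec k \<and> eim_mat q \<mu> k *\<^sub>v l' = vec k (\<lambda>i. q (Suc i) x)"
  have A: "eim_mat q \<mu> k \<in> carrier_mat k k" by (simp add: eim_mat_def)
  have "eim_mat q \<mu> k *\<^sub>v (l' - l) = 0\<^sub>v k"
    using l l' eq A by (simp add: mult_minus_distrib_mat_vec[of _ k k])
  then have "l' - l = 0\<^sub>v k"
    using det_0_iff_vec_prod_zero[OF A] assms(1) l l' minus_carrier_vec[of l' k l] by blast
  then show "l' = l"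
    using l l' by (auto simp: vec_eq_iff)
qed

lemma eim_coeff:
  assumes "det (eim_mat q \<mu> k) \<noteq> 0"
  shows "eim_coeff q \<mu> k x \<in> carrier_vec k"
    and "eim_mat q \<mu> k *\<^sub>v eim_coeff q \<mu> k x = vec k (\<lambda>i. q (Suc i) x)"
proof -
  let ?A = "eim_mat q \<mu> k" and ?b = "vec k (\<lambda>i. q (Suc i) x)"
  have A: "?A \<in> carrier_mat k k" by (simp add: eim_mat_def)
  obtain B where B: "?A * B = 1\<^sub>m k" "B \<in> carrier_mat k k"
    using det_non_zero_imp_unit[OF A assms, of "()"]
    by (auto simp: Units_def ring_mat_def)
  have l: "B *\<^sub>v ?b \<in> carrier_vec k" using B by auto
  have eq: "?A *\<^sub>v (B *\<^sub>v ?b) = ?b"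
    using assoc_mult_mat_vec[OF A B(2), of ?b] B(1) by simp
  have "eim_coeff q \<mu> k x = B *\<^sub>v ?b"
    by (rule eim_coeff_eqI[OF assms l eq])
  with l eq show "eim_coeff q \<mu> k x \<in> carrier_vec k" "?A *\<^sub>v eim_coeff q \<mu> k x = ?b"
    by simp_all
qed

text \<open>
  Interpolation at step \<open>k\<close> reproduces each of \<open>q 1, \<dots>, q k\<close> exactly: this is the linear system
  for the coefficients, read row by row.
\<close>

lemma eim_coeff_reproduces:
  assumes "det (eim_mat q \<mu> k) \<noteq> 0" "i < k"
  shows "(\<Sum>r<k. eim_coeff q \<mu> k x $ r * q (Suc i) (\<mu> (Suc r))) = q (Suc i) x"
  using index_eim_mat_mult_vec[OF eim_coeff(1)[OF assms(1), of x] assms(2), of q \<mu>]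
  by (simp add: eim_coeff(2)[OF assms(1)] assms(2))

text \<open>
  At an interpolation point the right-hand side of the linear system is a column of its matrix.
\<close>

lemma eim_coeff_at_point:
  assumes "det (eim_mat q \<mu> k) \<noteq> 0" "j < k"
  shows "eim_coeff q \<mu> k (\<mu> (Suc j)) = unit_vec k j"
proof (rule eim_coeff_eqI[OF assms(1)])
  have "(eim_mat q \<mu> k *\<^sub>v unit_vec k j) $ i = q (Suc i) (\<mu> (Suc j))" if "i < k" for i
    using that assms(2) by (simp add: eim_mat_def)
  then show "eim_mat q \<mu> k *\<^sub>v unit_vec k j = vec k (\<lambda>i. q (Suc i) (\<mu> (Suc j)))"
    by (intro eq_vecI) (auto simp: eim_mat_def)
qed simp

text \<open>
  The coefficients at step \<open>m\<close> are linear combinations of \<open>q 1, \<dots>, q m\<close>, so interpolation at any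
  later step reproduces them. Testing the interpolated vector in the system of step \<open>m\<close> shows this
  without an inverse matrix.
\<close>

lemma eim_coeff_interp:
  assumes m: "det (eim_mat q \<mu> m) \<noteq> 0" and k: "det (eim_mat q \<mu> k) \<noteq> 0"
    and "m \<le> k" "s < m"
  shows "(\<Sum>r<k. eim_coeff q \<mu> k x $ r * eim_coeff q \<mu> m (\<mu> (Suc r)) $ s) = eim_coeff q \<mu> m x $ s"
proof -
  define w where "w = vec m (\<lambda>s. \<Sum>r<k. eim_coeff q \<mu> k x $ r * eim_coeff q \<mu> m (\<mu> (Suc r)) $ s)"
  have "eim_coeff q \<mu> m x = w"
  proof (rule eim_coeff_eqI[OF m])
    show w: "w \<in> carrier_vec m" by (simp add: w_def)
    show "eim_mat q \<mu> m *\<^sub>v w = vec m (\<lambda>i. q (Suc i) x)"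
    proof (rule eq_vecI)
      fix i assume "i < dim_vec (vec m (\<lambda>i. q (Suc i) x))"
      then have i: "i < m" by simp
      have "(eim_mat q \<mu> m *\<^sub>v w) $ i
          = (\<Sum>s<m. \<Sum>r<k. eim_coeff q \<mu> k x $ r *
               (eim_coeff q \<mu> m (\<mu> (Suc r)) $ s * q (Suc i) (\<mu> (Suc s))))"
        using index_eim_mat_mult_vec[OF w i] by (simp add: w_def sum_distrib_right mult.assoc)
      also have "\<dots> = (\<Sum>r<k. eim_coeff q \<mu> k x $ r *
               (\<Sum>s<m. eim_coeff q \<mu> m (\<mu> (Suc r)) $ s * q (Suc i) (\<mu> (Suc s))))"
        by (subst sum.swap) (simp add: sum_distrib_left)
      also have "\<dots> = (\<Sum>r<k. eim_coeff q \<mu> k x $ r * q (Suc i) (\<mu> (Suc r)))"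
        by (simp add: eim_coeff_reproduces[OF m i])
      also have "\<dots> = q (Suc i) x"
        using eim_coeff_reproduces[OF k, of i] i \<open>m \<le> k\<close> by simp
      finally show "(eim_mat q \<mu> m *\<^sub>v w) $ i = vec m (\<lambda>i. q (Suc i) x) $ i"
        using i by simp
    qed (simp add: eim_mat_def)
  qed
  then show ?thesis
    using \<open>s < m\<close> by (simp add: w_def)
qed

lemma eim_interp_carrier:
  assumes "\<forall>r\<in>{1..k}. f (\<mu> r) \<in> carrier_vec \<sigma>"
  shows "eim_interp \<sigma> q \<mu> k f x \<in> carrier_vec \<sigma>"
  unfolding eim_interp_def by (rule finsum_vec_closed) (use assms in auto)

lemma index_eim_interp:
  assumes "\<forall>r\<in>{1..k}. f (\<mu> r) \<in> carrier_vec \<sigma>" "a < \<sigma>"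
  shows "eim_interp \<sigma> q \<mu> k f x $ a = (\<Sum>r<k. eim_coeff q \<mu> k x $ r * f (\<mu> (Suc r)) $ a)"
proof -
  have f: "dim_vec (f (\<mu> (Suc r))) = \<sigma>" if "r < k" for r
    using assms(1) that by (intro carrier_vecD) simp
  have a: "a < \<sigma>" by fact
  have "eim_interp \<sigma> q \<mu> k f x $ a
      = (\<Sum>r\<in>{1..k}. (eim_coeff q \<mu> k x $ (r - 1) \<cdot>\<^sub>v f (\<mu> r)) $ a)"
    unfolding eim_interp_def by (rule index_finsum_vec) (use assms in auto)
  also have "\<dots> = (\<Sum>r<k. (eim_coeff q \<mu> k x $ r \<cdot>\<^sub>v f (\<mu> (Suc r))) $ a)"
    by (simp add: sum.atLeast1_atMost_eq)
  also have "\<dots> = (\<Sum>r<k. eim_coeff q \<mu> k x $ r * f (\<mu> (Suc r)) $ a)"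
    using f a by (intro sum.cong) auto
  finally show ?thesis .
qed

lemma eim_interp_at_point:
  assumes "det (eim_mat q \<mu> k) \<noteq> 0" "j < k"
    and f: "\<forall>r\<in>{1..k}. f (\<mu> r) \<in> carrier_vec \<sigma>"
  shows "eim_interp \<sigma> q \<mu> k f (\<mu> (Suc j)) = f (\<mu> (Suc j))"
proof (rule eq_vecI)
  have fj: "f (\<mu> (Suc j)) \<in> carrier_vec \<sigma>" using f assms(2) by simp
  show "dim_vec (eim_interp \<sigma> q \<mu> k f (\<mu> (Suc j))) = dim_vec (f (\<mu> (Suc j)))"
    using eim_interp_carrier[of k f \<mu> \<sigma>, OF f] fj by (auto simp: carrier_vecD)
  fix a assume "a < dim_vec (f (\<mu> (Suc j)))"
  then have a: "a < \<sigma>" using fj by simp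
  have "eim_interp \<sigma> q \<mu> k f (\<mu> (Suc j)) $ a = (\<Sum>r<k. unit_vec k j $ r * f (\<mu> (Suc r)) $ a)"
    using index_eim_interp[of k f \<mu> \<sigma>, OF f a] eim_coeff_at_point[OF assms(1,2)] by simp
  also have "\<dots> = (\<Sum>r<k. if r = j then f (\<mu> (Suc r)) $ a else 0)"
    using assms(2) by (intro sum.cong) auto
  also have "\<dots> = f (\<mu> (Suc j)) $ a"
    using assms(2) by simp
  finally show "eim_interp \<sigma> q \<mu> k f (\<mu> (Suc j)) $ a = f (\<mu> (Suc j)) $ a" .
qed

text \<open>
  The identity \<open>I\<^sup>k I\<^sup>m = I\<^sup>m\<close>: exchanging the two sums moves the interpolation at step \<open>k\<close> from
  the values of \<open>f\<close> to the coefficients of step \<open>m\<close>, where it acts trivially.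
\<close>

lemma eim_interp_interp:
  assumes m: "det (eim_mat q \<mu> m) \<noteq> 0" and k: "det (eim_mat q \<mu> k) \<noteq> 0" and "m \<le> k"
    and f: "\<forall>r\<in>{1..k}. f (\<mu> r) \<in> carrier_vec \<sigma>"
  shows "eim_interp \<sigma> q \<mu> k (eim_interp \<sigma> q \<mu> m f) x = eim_interp \<sigma> q \<mu> m f x"
proof (rule eq_vecI)
  have f': "\<forall>r\<in>{1..m}. f (\<mu> r) \<in> carrier_vec \<sigma>" using f \<open>m \<le> k\<close> by simp
  have c: "eim_interp \<sigma> q \<mu> m f y \<in> carrier_vec \<sigma>" for y by (rule eim_interp_carrier) (rule f')
  have "eim_interp \<sigma> q \<mu> k (eim_interp \<sigma> q \<mu> m f) x \<in> carrier_vec \<sigma>"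
    by (rule eim_interp_carrier) (simp add: c)
  then show "dim_vec (eim_interp \<sigma> q \<mu> k (eim_interp \<sigma> q \<mu> m f) x) = dim_vec (eim_interp \<sigma> q \<mu> m f x)"
    using c[of x] by (simp add: carrier_vecD)
  fix a assume "a < dim_vec (eim_interp \<sigma> q \<mu> m f x)"
  then have a: "a < \<sigma>" using c[of x] by simp
  note idx = index_eim_interp[of m f \<mu> \<sigma>, OF f' a]
  have "eim_interp \<sigma> q \<mu> k (eim_interp \<sigma> q \<mu> m f) x $ a
      = (\<Sum>r<k. eim_coeff q \<mu> k x $ r * eim_interp \<sigma> q \<mu> m f (\<mu> (Suc r)) $ a)"
    by (rule index_eim_interp) (simp_all add: c a)
  also have "\<dots> = (\<Sum>r<k. \<Sum>s<m. eim_coeff q \<mu> k x $ r * eim_coeff q \<mu> m (\<mu> (Suc r)) $ s * f (\<mu> (Suc s)) $ a)"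
    by (simp add: idx sum_distrib_left mult.assoc)
  also have "\<dots> = (\<Sum>s<m. (\<Sum>r<k. eim_coeff q \<mu> k x $ r * eim_coeff q \<mu> m (\<mu> (Suc r)) $ s) * f (\<mu> (Suc s)) $ a)"
    by (subst sum.swap) (simp add: sum_distrib_right)
  also have "\<dots> = (\<Sum>s<m. eim_coeff q \<mu> m x $ s * f (\<mu> (Suc s)) $ a)"
    by (simp add: eim_coeff_interp[OF m k \<open>m \<le> k\<close>])
  also have "\<dots> = eim_interp \<sigma> q \<mu> m f x $ a"
    by (simp add: idx)
  finally show "eim_interp \<sigma> q \<mu> k (eim_interp \<sigma> q \<mu> m f) x $ a = eim_interp \<sigma> q \<mu> m f x $ a" .
qed

text \<open>
  An interpolant depends on a function only through its values at the points. Linearity is stated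
  in terms of these values, because an intermediate residual is known to be a difference only on
  the trial set.
\<close>

lemma eim_interp_diff:
  assumes f: "\<forall>r\<in>{1..k}. f (\<mu> r) \<in> carrier_vec \<sigma>"
    and g: "\<forall>r\<in>{1..k}. g (\<mu> r) \<in> carrier_vec \<sigma>"
    and h: "\<forall>r\<in>{1..k}. h (\<mu> r) = f (\<mu> r) - g (\<mu> r)"
  shows "eim_interp \<sigma> q \<mu> k h x = eim_interp \<sigma> q \<mu> k f x - eim_interp \<sigma> q \<mu> k g x"
proof -
  have h': "\<forall>r\<in>{1..k}. h (\<mu> r) \<in> carrier_vec \<sigma>"
    using f g h by simp
  note carr = eim_interp_carrier[of k f \<mu> \<sigma>, OF f] eim_interp_carrier[of k g \<mu> \<sigma>, OF g]
    eim_interp_carrier[of k h \<mu> \<sigma>, OF h']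
  have "eim_interp \<sigma> q \<mu> k h x $ a = eim_interp \<sigma> q \<mu> k f x $ a - eim_interp \<sigma> q \<mu> k g x $ a"
    if a: "a < \<sigma>" for a
  proof -
    have "h (\<mu> (Suc r)) $ a = f (\<mu> (Suc r)) $ a - g (\<mu> (Suc r)) $ a" if "r < k" for r
      using g h that a by (simp add: carrier_vecD[OF bspec[OF g]])
    then show ?thesis
      by (simp add: index_eim_interp[of k f \<mu> \<sigma>, OF f a] index_eim_interp[of k g \<mu> \<sigma>, OF g a]
          index_eim_interp[of k h \<mu> \<sigma>, OF h' a] right_diff_distrib sum_subtractf)
  qed
  then show ?thesis
    using carr[of q x] by (intro eq_vecI) (auto simp: carrier_vecD)
qed

lemma eim_run_point:
  assumes "eim_run P \<sigma> n v p \<mu> q" "r \<in> {1..n}"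
  shows "\<mu> r \<in> P" "v (\<mu> r) \<in> carrier_vec \<sigma>"
proof -
  show P: "\<mu> r \<in> P"
  proof (cases "r = 1")
    case False
    then have "r - 1 \<in> {1..<n}" "r - 1 + 1 = r" using assms(2) by auto
    then have "eim_select P \<sigma> (eim_residual \<sigma> q \<mu> (r - 1) v) (p r) (\<mu> r) (q r)"
      using assms(1) unfolding eim_run_def by metis
    then show ?thesis by (auto simp: eim_select_def is_arg_max_def)
  qed (use assms(1) in \<open>auto simp: eim_run_def eim_select_def is_arg_max_def\<close>)
  then show "v (\<mu> r) \<in> carrier_vec \<sigma>"
    using assms(1) by (auto simp: eim_run_def)
qed

lemma eim_residual_0:
  assumes "v x \<in> carrier_vec \<sigma>"
  shows "eim_residual \<sigma> q \<mu> 0 v x = v x"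
  using assms by (simp add: eim_residual_def eim_interp_def finsum_vec_empty)

text \<open>
  The first selection is also driven by a residual, the one of step \<open>0\<close>, where nothing is
  interpolated yet.
\<close>

lemma eim_run_q:
  assumes run: "eim_run P \<sigma> n v p \<mu> q" and "i < n" "x \<in> P"
  obtains a where "a < \<sigma>" "eim_residual \<sigma> q \<mu> i v (\<mu> (Suc i)) $ a \<noteq> 0"
    "q (Suc i) x = eim_residual \<sigma> q \<mu> i v x $ a / eim_residual \<sigma> q \<mu> i v (\<mu> (Suc i)) $ a"
proof (cases "i = 0")
  case True
  then show ?thesis
    using run that[of "p 1"] \<open>x \<in> P\<close>
    by (auto simp: eim_run_def eim_select_def is_arg_max_def eim_residual_0 Pi_iff)
next
  case False
  then have "i \<in> {1..<n}" using \<open>i < n\<close> by simp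
  then show ?thesis
    using run that[of "p (Suc i)"] \<open>x \<in> P\<close>
    by (auto simp: eim_run_def eim_select_def is_arg_max_def)
qed

text \<open>
  The matrix of step \<open>k\<close> is upper triangular with unit diagonal: \<open>q (Suc i)\<close> is a normalised
  residual of step \<open>i\<close>, which vanishes at the points \<open>\<mu> 1, \<dots>, \<mu> i\<close>. That vanishing relies on
  the invertibility of the matrix of step \<open>i\<close>, hence strong induction.
\<close>

lemma eim_run_det:
  assumes run: "eim_run P \<sigma> n v p \<mu> q"
  shows "k \<le> n \<Longrightarrow> det (eim_mat q \<mu> k) \<noteq> 0"
proof (induction k rule: less_induct)
  case (less k)
  have A: "eim_mat q \<mu> k \<in> carrier_mat k k" by (simp add: eim_mat_def)
  have diag: "q (Suc i) (\<mu> (Suc i)) = 1" if "i < k" for i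
    using eim_run_q[OF run, of i "\<mu> (Suc i)"] eim_run_point(1)[OF run, of "Suc i"] that less.prems
    by auto
  have below: "q (Suc i) (\<mu> (Suc j)) = 0" if "j < i" "i < k" for i j
  proof -
    have r: "Suc j \<in> {1..n}" using that less.prems by auto
    have v: "\<forall>r\<in>{1..i}. v (\<mu> r) \<in> carrier_vec \<sigma>"
      using eim_run_point(2)[OF run] \<open>i < k\<close> less.prems by auto
    have "eim_residual \<sigma> q \<mu> i v (\<mu> (Suc j)) = 0\<^sub>v \<sigma>"
      unfolding eim_residual_def
      using eim_interp_at_point[of q \<mu> i j v \<sigma>, OF _ \<open>j < i\<close> v] less.IH[of i] that less.prems
        eim_run_point(2)[OF run r] by auto
    moreover have "i < n" using that less.prems by simp
    ultimately show ?thesis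
      using eim_run_q[OF run _ eim_run_point(1)[OF run r], of i] by auto
  qed
  have "upper_triangular (eim_mat q \<mu> k)"
    by (rule upper_triangularI) (simp add: eim_mat_def below)
  moreover have "diag_mat (eim_mat q \<mu> k) = replicate k 1"
    by (rule nth_equalityI) (auto simp: diag_mat_def eim_mat_def diag)
  ultimately show ?case
    using det_upper_triangular[OF _ A] by simp
qed

text \<open>
  Since \<open>I\<^sup>i\<^sup>+\<^sup>1 I\<^sup>i = I\<^sup>i\<close>, subtracting the interpolant of \<open>v - I\<^sup>i v\<close> leaves
  \<open>v - I\<^sup>i v - (I\<^sup>i\<^sup>+\<^sup>1 v - I\<^sup>i v)\<close>, in which the old interpolant cancels.
\<close>

lemma eim_intermediate_eq_residual:
  assumes run: "eim_run P \<sigma> n v p \<mu> q"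
  shows "i \<le> n \<Longrightarrow> x \<in> P \<Longrightarrow> eim_intermediate \<sigma> q \<mu> v i x = eim_residual \<sigma> q \<mu> i v x"
proof (induction i arbitrary: x)
  case 0
  then show ?case
    using run by (auto simp: eim_run_def eim_residual_0 Pi_iff)
next
  case (Suc i)
  let ?I = "\<lambda>j. eim_interp \<sigma> q \<mu> j v"
  have v: "\<forall>r\<in>{1..Suc i}. v (\<mu> r) \<in> carrier_vec \<sigma>"
    using eim_run_point(2)[OF run] Suc.prems by auto
  have I: "?I j y \<in> carrier_vec \<sigma>" if "j \<le> Suc i" for j y
    by (rule eim_interp_carrier) (use v that in auto)
  have vx: "v x \<in> carrier_vec \<sigma>" using run Suc.prems by (auto simp: eim_run_def)
  have "eim_intermediate \<sigma> q \<mu> v i (\<mu> r) = v (\<mu> r) - ?I i (\<mu> r)" if "r \<in> {1..Suc i}" for r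
    using Suc.IH[of "\<mu> r"] eim_run_point(1)[OF run, of r] that Suc.prems
    by (simp add: eim_residual_def)
  then have "eim_interp \<sigma> q \<mu> (Suc i) (eim_intermediate \<sigma> q \<mu> v i) x
      = ?I (Suc i) x - eim_interp \<sigma> q \<mu> (Suc i) (?I i) x"
    by (intro eim_interp_diff v) (simp_all add: I)
  also have "eim_interp \<sigma> q \<mu> (Suc i) (?I i) x = ?I i x"
    by (rule eim_interp_interp) (use eim_run_det[OF run] Suc.prems v in auto)
  finally have "eim_intermediate \<sigma> q \<mu> v (Suc i) x = (v x - ?I i x) - (?I (Suc i) x - ?I i x)"
    using Suc.IH[of x] Suc.prems by (simp add: eim_residual_def)
  also have "\<dots> = v x - ?I (Suc i) x"
    using vx I[of i x] I[of "Suc i" x] by (intro eq_vecI) (auto simp: carrier_vecD)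
  finally show ?case by (simp add: eim_residual_def)
qed

section \<open>Orthogonal projection\<close>

text \<open>
  The difference of two candidates for the projection lies in the subspace and is orthogonal to
  it, hence to itself.
\<close>

lemma orth_proj_eqI:
  assumes W: "W \<subseteq> carrier_vec n" "\<forall>a\<in>W. \<forall>b\<in>W. a - b \<in> W"
    and x: "x \<in> carrier_vec n" and w: "w \<in> W" "\<forall>y\<in>W. (x - w) \<bullet>c y = 0"
  shows "orth_proj W x = w"
  unfolding orth_proj_def
proof (rule the_equality)
  show "w \<in> W \<and> (\<forall>y\<in>W. (x - w) \<bullet>c y = 0)" using w by simp
next
  fix w' assume w': "w' \<in> W \<and> (\<forall>y\<in>W. (x - w') \<bullet>c y = 0)"
  let ?d = "w' - w"
  have carr: "w \<in> carrier_vec n" "w' \<in> carrier_vec n" "?d \<in> carrier_vec n"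
    using W w w' by auto
  have "?d = (x - w) - (x - w')"
    using carr x by (intro eq_vecI) auto
  then have "?d \<bullet>c ?d = (x - w) \<bullet>c ?d - (x - w') \<bullet>c ?d"
    using minus_scalar_prod_distrib[of "x - w" n "x - w'" "conjugate ?d"] carr x by simp
  also have "\<dots> = 0" using w w' W(2) by simp
  finally have "?d = 0\<^sub>v n" using conjugate_square_eq_0_vec[OF carr(3)] by simp
  then show "w' = w" using carr by (auto simp: vec_eq_iff)
qed

text \<open>
  Removing some \<open>w\<close> of the subspace from \<open>x\<close> shifts the projection by exactly \<open>w\<close>, so that the
  residual does not notice it. In the Gram--Schmidt procedure \<open>w\<close> is the projection of \<open>x\<close> onto
  a smaller subspace. The vector \<open>w'\<close> witnesses that the projection of \<open>x\<close> exists.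
\<close>

lemma residual_of_residual_orth_proj:
  assumes W': "W' \<subseteq> carrier_vec n" "\<forall>a\<in>W'. \<forall>b\<in>W'. a - b \<in> W'"
    and x: "x \<in> carrier_vec n" and w: "w \<in> W'"
    and w': "w' \<in> W'" "\<forall>y\<in>W'. (x - w') \<bullet>c y = 0"
  shows "(x - w) - orth_proj W' (x - w) = x - orth_proj W' x"
proof -
  have carr: "w \<in> carrier_vec n" "w' \<in> carrier_vec n" using W' w w' by auto
  have "(x - w) - (w' - w) = x - w'"
    using carr x by (intro eq_vecI) auto
  moreover have "orth_proj W' (x - w) = w' - w"
    using W'(2) w w' carr x calculation by (intro orth_proj_eqI[OF W']) auto
  moreover have "orth_proj W' x = w'"
    by (rule orth_proj_eqI[OF W' x w'])
  ultimately show ?thesis by simp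
qed

section \<open>Gram--Schmidt\<close>

lemma span_diff:
  fixes S :: "complex vec set"
  assumes S: "S \<subseteq> carrier_vec n"
    and "a \<in> LinearCombinations.module.span class_ring (module_vec TYPE(complex) n) S"
    and "b \<in> LinearCombinations.module.span class_ring (module_vec TYPE(complex) n) S"
  shows "a - b \<in> LinearCombinations.module.span class_ring (module_vec TYPE(complex) n) S"
proof -
  interpret cof_vec_space n "TYPE(complex)" .
  have carr: "a \<in> carrier_vec n" "b \<in> carrier_vec n" using assms span_closed[OF S] by auto
  have "- b \<in> span S" using span_neg[of S b] assms by simp
  then have "a + - b \<in> span S" using span_add[of S a "- b"] assms carr by simp
  moreover have "a + - b = a - b" using carr by (intro eq_vecI) auto
  ultimately show ?thesis by simp
qed

lemma cscalar_prod_eq_0_sym: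
  fixes x y :: "complex vec"
  assumes "x \<in> carrier_vec n" "y \<in> carrier_vec n" "x \<bullet>c y = 0"
  shows "y \<bullet>c x = 0"
  using assms conjugate_conjugate_sprod[OF assms(2,1)]
  by (metis conjugate_vec_sprod_comm conjugate_zero)

lemma orthogonal_to_span:
  assumes z: "z \<in> carrier_vec n" and S: "finite S" "S \<subseteq> carrier_vec n"
    and orth: "\<And>u. u \<in> S \<Longrightarrow> z \<bullet>c u = 0"
    and y: "y \<in> LinearCombinations.module.span class_ring (module_vec TYPE(complex) n) S"
  shows "z \<bullet>c y = 0"
proof -
  interpret cof_vec_space n "TYPE(complex)" .
  obtain c where c: "y = lincomb c S"
    using y finite_in_span[of S y] S by auto
  have yc: "y \<in> carrier_vec n" using y span_closed[OF S(2)] by auto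
  have "y \<bullet>c z = (\<Sum>u\<in>S. (c u \<cdot>\<^sub>v u) \<bullet>c z)"
    unfolding c lincomb_def using S z by (simp add: finsum_scalar_prod_sum Pi_iff subset_iff)
  also have "\<dots> = 0"
  proof (rule sum.neutral, rule ballI)
    fix u assume u: "u \<in> S"
    then have "u \<bullet>c z = 0" using cscalar_prod_eq_0_sym[OF z _ orth] S by auto
    then show "(c u \<cdot>\<^sub>v u) \<bullet>c z = 0"
      using u S(2) z by (simp add: subset_iff carrier_vecD)
  qed
  finally show ?thesis using cscalar_prod_eq_0_sym[OF yc z] by simp
qed

text \<open>
  The correction term \<open>adjuster n x us\<close> of the Gram--Schmidt procedure is minus the orthogonal
  projection of \<open>x\<close>: adding it to \<open>x\<close> makes \<open>x\<close> orthogonal to every vector of \<open>us\<close>.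
\<close>

lemma orth_proj_exists:
  assumes us: "set us \<subseteq> carrier_vec n" "corthogonal us" and x: "x \<in> carrier_vec n"
  obtains w where "w \<in> LinearCombinations.module.span class_ring (module_vec TYPE(complex) n) (set us)"
    and "\<forall>y\<in>LinearCombinations.module.span class_ring (module_vec TYPE(complex) n) (set us). (x - w) \<bullet>c y = 0"
proof
  interpret cof_vec_space n "TYPE(complex)" .
  let ?a = "adjuster n x us"
  have dist: "distinct us" using us(2) by (rule corthogonal_distinct)
  have a: "?a \<in> span (set us)" "?a \<in> carrier_vec n"
    using adjuster_in_span[OF x us(1) dist] adjuster_carrier[OF x us(1) dist] by auto
  show "- ?a \<in> span (set us)" using span_neg[OF _ a(1)] us vec_neg[OF a(2)] by simp
  have "x - - ?a = ?a + x" using a x by (intro eq_vecI) auto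
  then have "(x - - ?a) \<bullet>c u = 0" if "u \<in> set us" for u
    using adjust_zero[OF us x] that by (auto simp: in_set_conv_nth)
  then show "\<forall>y\<in>span (set us). (x - - ?a) \<bullet>c y = 0"
    using orthogonal_to_span[of "x - - ?a" n "set us"] us(1) x a(2) by simp
qed

lemma corthogonal_take: "corthogonal us \<Longrightarrow> corthogonal (take i us)"
  by (auto simp: corthogonal_def)

text \<open>
  The span onto which step \<open>i\<close> projects is contained in that of step \<open>Suc i\<close>, so the projection
  removed at step \<open>i\<close> does not change the residual of step \<open>Suc i\<close>.
\<close>

lemma gs_intermediate_eq_residual:
  assumes vs: "is_basis_list n vs" and x: "x \<in> carrier_vec n"
  shows "gs_intermediate n vs x i = gs_residual n vs i x"
proof -
  interpret cof_vec_space n "TYPE(complex)" .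
  let ?us = "gram_schmidt n vs"
  let ?W = "\<lambda>i. span (set (take i ?us))"
  have "set vs \<subseteq> carrier_vec n" "distinct vs" "lin_indpt (set vs)"
    using vs by (auto simp: is_basis_list_def basis_def)
  note gs = gram_schmidt_result[OF this refl]
  have us: "set (take i ?us) \<subseteq> carrier_vec n" "corthogonal (take i ?us)" for i
    using gs(2,3) set_take_subset[of i ?us] by (auto intro: corthogonal_take)
  have W: "?W i \<subseteq> carrier_vec n" for i using span_closed[OF us(1)] by auto
  have Wd: "\<forall>a\<in>?W i. \<forall>b\<in>?W i. a - b \<in> ?W i" for i
    using span_diff[OF us(1)] by blast
  have proj: "gs_proj n vs i x \<in> ?W i \<and> (\<forall>y \<in> ?W i. (x - gs_proj n vs i x) \<bullet>c y = 0)" for i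
  proof (rule orth_proj_exists[OF us x, of i])
    fix w assume w: "w \<in> ?W i" "\<forall>y\<in>?W i. (x - w) \<bullet>c y = 0"
    moreover have "gs_proj n vs i x = w"
      unfolding gs_proj_def by (rule orth_proj_eqI[OF W Wd x w])
    ultimately show ?thesis by simp
  qed
  show ?thesis
  proof (induction i)
    case 0
    have "gs_proj n vs 0 x = 0\<^sub>v n" using proj[of 0] by (simp add: span_empty)
    then show ?case using x by (simp add: gs_residual_def)
  next
    case (Suc i)
    have "gs_proj n vs i x \<in> ?W (Suc i)"
      using proj[of i] span_is_monotone[OF set_take_subset_set_take[of i "Suc i" ?us]] by auto
    then have "(x - gs_proj n vs i x) - orth_proj (?W (Suc i)) (x - gs_proj n vs i x)
        = x - orth_proj (?W (Suc i)) x"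
      by (rule residual_of_residual_orth_proj[OF W Wd x]) (use proj[of "Suc i"] in auto)
    then show ?case
      by (simp add: Suc.IH gs_residual_def gs_proj_def)
  qed
qed

theorem proposition3p4p1:
  fixes k n \<sigma> :: nat
    and P :: "'a set" and v :: "'a \<Rightarrow> complex vec"
    and p :: "nat \<Rightarrow> nat" and \<mu> :: "nat \<Rightarrow> 'a" and q :: "nat \<Rightarrow> 'a \<Rightarrow> complex"
    and vs :: "complex vec list"
  assumes "1 \<le> k" and "k \<le> n"
  shows "(eim_run P \<sigma> n v p \<mu> q \<longrightarrow>
            (\<forall>x\<in>P. eim_stab_residual \<sigma> q \<mu> k v x = eim_residual \<sigma> q \<mu> k v x)) \<and>
         (is_basis_list n vs \<longrightarrow>
            gs_stab_residual n vs k (vs ! (k - 1)) = gs_residual n vs k (vs ! (k - 1)))"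
proof (intro conjI impI ballI)
  fix x assume "eim_run P \<sigma> n v p \<mu> q" "x \<in> P"
  then show "eim_stab_residual \<sigma> q \<mu> k v x = eim_residual \<sigma> q \<mu> k v x"
    using \<open>k \<le> n\<close> by (simp add: eim_stab_residual_def eim_intermediate_eq_residual)
next
  assume vs: "is_basis_list n vs"
  interpret cof_vec_space n "TYPE(complex)" .
  have "set vs \<subseteq> carrier_vec n" "k - 1 < length vs"
    using vs assms by (auto simp: is_basis_list_def basis_def)
  then have "vs ! (k - 1) \<in> carrier_vec n" by auto
  then show "gs_stab_residual n vs k (vs ! (k - 1)) = gs_residual n vs k (vs ! (k - 1))"
    unfolding gs_stab_residual_def by (rule gs_intermediate_eq_residual[OF vs])
qed

end
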